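(* Let $n=1+n_2+n_3=p+q$ with $n_2,n_3,p,q$ positive integers, let $G=U(n)$, and let $L=U(1)\times U(n_2)\times U(n_3)$ and $H=U(p)\times U(q)$ be the natural block-diagonal subgroups of $G$. Set $l:=\min(2p,2q,2n_2+1,2n_3+1)$ (so $[\tfrac l2]=\min(p,q,n_2,n_3)$ and $[\tfrac{l+1}2]=\min(p,q,n_2+1,n_3+1)$). Define the abelian subspaces of $\mathfrak{u}(n)$ $$\mathfrak b':=\sum_{i=1}^{[\frac{l+1}2]}\mathbb{R}(E_{i,n+1-i}-E_{n+1-i,i}),\qquad \mathfrak b'':=\sum_{i=1}^{[\frac l2]}\mathbb{R}(E_{i+1,n+1-i}-E_{n+1-i,i+1}),$$ the toral subgroups $B':=\exp\mathfrak b'$ and $B'':=\exp\mathfrak b''$ of $O(n)$, and the subset $B:=B''B'=\{xy:x\in B'',y\in B'\}\subset O(n)$. Then $G=LBH$.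
   Context: $E_{ij}$ denotes the $n\times n$ matrix unit with $1$ in position $(i,j)$ and $0$ elsewhere; $[x]$ denotes the integer part of $x$. $LBH=\{xbh:x\in L,b\in B,h\in H\}$. *)

theory Defs
  imports Complex_Main "Jordan_Normal_Form.Matrix"
begin

definition ctrans :: "complex mat \<Rightarrow> complex mat" where
  "ctrans A = mat (dim_col A) (dim_row A) (\<lambda>(i,j). cnj (A $$ (j,i)))"

definition unitary_grp :: "nat \<Rightarrow> complex mat set" where
  "unitary_grp n = {U \<in> carrier_mat n n. U * ctrans U = 1\<^sub>m n}"

text \<open>Block-diagonal unitary matrices: entries vanish unless row and column
  lie in the same block; blk assigns a block label to each 0-based index.\<close>
definition block_unitary :: "nat \<Rightarrow> (nat \<Rightarrow> nat) \<Rightarrow> complex mat set" where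
  "block_unitary n blk = {U \<in> unitary_grp n. \<forall>i<n. \<forall>j<n. blk i \<noteq> blk j \<longrightarrow> U $$ (i,j) = 0}"

text \<open>L = U(1) x U(n2) x U(n3): blocks {1}, {2..1+n2}, {2+n2..n} (1-based).\<close>
definition L_grp :: "nat \<Rightarrow> nat \<Rightarrow> complex mat set" where
  "L_grp n2 n3 = block_unitary (1 + n2 + n3)
     (\<lambda>i. if i = 0 then 0 else if i \<le> n2 then 1 else 2)"

text \<open>H = U(p) x U(q): blocks {1..p}, {p+1..p+q} (1-based).\<close>
definition H_grp :: "nat \<Rightarrow> nat \<Rightarrow> complex mat set" where
  "H_grp p q = block_unitary (p + q) (\<lambda>i. if i < p then 0 else 1)"

text \<open>Matrix unit E_{ij} (1-based indices) of size n.\<close>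
definition Eunit :: "nat \<Rightarrow> nat \<Rightarrow> nat \<Rightarrow> complex mat" where
  "Eunit n i j = mat n n (\<lambda>(a,b). if a = i - 1 \<and> b = j - 1 then 1 else 0)"

definition mexp :: "complex mat \<Rightarrow> complex mat" where
  "mexp A = mat (dim_row A) (dim_col A)
     (\<lambda>(i,j). \<Sum>k. (A ^\<^sub>m k) $$ (i,j) / of_nat (fact k))"

definition b1 :: "nat \<Rightarrow> nat \<Rightarrow> complex mat set" where
  "b1 n m = {A. \<exists>t :: nat \<Rightarrow> real. A = mat n n (\<lambda>ab.
       \<Sum>i\<in>{1..m}. complex_of_real (t i) * (Eunit n i (n+1-i) - Eunit n (n+1-i) i) $$ ab)}"

definition b2 :: "nat \<Rightarrow> nat \<Rightarrow> complex mat set" where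
  "b2 n m = {A. \<exists>t :: nat \<Rightarrow> real. A = mat n n (\<lambda>ab.
       \<Sum>i\<in>{1..m}. complex_of_real (t i) * (Eunit n (i+1) (n+1-i) - Eunit n (n+1-i) (i+1)) $$ ab)}"

end

theory Submission
  imports Defs "Jordan_Normal_Form.Determinant"
begin

text \<open>Herringbone stitch, by induction on \<open>n\<close>. A unitary matrix carries any vector to any other
  of the same norm, so the blocks of \<open>H\<close> bring the first row of \<open>g\<close> into the form
  \<open>(cos \<theta>, 0, \<dots>, 0, sin \<theta>)\<close>. Hence \<open>g = (1 \<oplus> u) R h\<close> with \<open>R\<close> a rotation in the plane of the
  first and last coordinate. The matrix \<open>u\<close> matters only modulo \<open>U(n2) \<times> U(n3)\<close> on the left and,
  through the elements of \<open>H\<close> commuting with \<open>R\<close>, modulo \<open>U(p-1) \<times> U(q-1) \<times> 1\<close> on the right. After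
  inversion and reversal of the indices this is the same problem for
  \<open>n - 1 = 1 + (q-1) + (p-1) = n3 + n2\<close>, and it exchanges the roles of \<open>B'\<close> and \<open>B''\<close>.\<close>

section \<open>Unitary matrices\<close>

declare index_mult_mat(1) [simp del]

lemma mult_mat_entry:
  assumes "A \<in> carrier_mat n m" "B \<in> carrier_mat m r" "i < n" "j < r"
  shows "(A * B) $$ (i,j) = (\<Sum>k<m. A $$ (i,k) * B $$ (k,j))"
  using assms by (simp add: index_mult_mat(1) scalar_prod_def atLeast0LessThan)

lemma ctrans_carrier [simp]: "A \<in> carrier_mat n m \<Longrightarrow> ctrans A \<in> carrier_mat m n"
  by (simp add: ctrans_def)

lemma ctrans_entry [simp]:
  "A \<in> carrier_mat n m \<Longrightarrow> i < m \<Longrightarrow> j < n \<Longrightarrow> ctrans A $$ (i,j) = cnj (A $$ (j,i))"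
  by (auto simp: ctrans_def)

lemma ctrans_ctrans [simp]: "ctrans (ctrans A) = A"
  by (auto simp: ctrans_def)

lemma ctrans_mult:
  assumes A: "A \<in> carrier_mat n m" and B: "B \<in> carrier_mat m r"
  shows "ctrans (A * B) = ctrans B * ctrans A"
proof (rule eq_matI)
  fix i j assume "i < dim_row (ctrans B * ctrans A)" "j < dim_col (ctrans B * ctrans A)"
  with A B have ij: "i < r" "j < n" by (auto simp: ctrans_def)
  have "ctrans (A * B) $$ (i,j) = cnj (\<Sum>k<m. A $$ (j,k) * B $$ (k,i))"
    using A B ij by (simp add: ctrans_entry[of _ n r] mult_mat_entry[OF A B])
  also have "\<dots> = (\<Sum>k<m. ctrans B $$ (i,k) * ctrans A $$ (k,j))"
    using A B ij by (simp add: mult.commute)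
  also have "\<dots> = (ctrans B * ctrans A) $$ (i,j)"
    using A B ij by (simp add: mult_mat_entry[of _ r m _ n])
  finally show "ctrans (A * B) $$ (i,j) = (ctrans B * ctrans A) $$ (i,j)" .
qed (use A B in \<open>auto simp: ctrans_def\<close>)

lemma unitary_grp_iff_orthonormal_rows:
  "U \<in> unitary_grp n \<longleftrightarrow> U \<in> carrier_mat n n \<and>
     (\<forall>i<n. \<forall>j<n. (\<Sum>k<n. U $$ (i,k) * cnj (U $$ (j,k))) = (if i = j then 1 else 0))"
proof (cases "U \<in> carrier_mat n n")
  case U: True
  have entry: "(U * ctrans U) $$ (i,j) = (\<Sum>k<n. U $$ (i,k) * cnj (U $$ (j,k)))"
    if "i < n" "j < n" for i j
    using U that by (simp add: mult_mat_entry[of _ n n _ n] ctrans_entry[of _ n n])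
  have "U * ctrans U = 1\<^sub>m n \<longleftrightarrow>
      (\<forall>i<n. \<forall>j<n. (U * ctrans U) $$ (i,j) = (if i = j then 1 else 0))"
    using U carrier_matD[OF ctrans_carrier[OF U]] by auto
  with U entry show ?thesis by (simp add: unitary_grp_def)
qed (simp add: unitary_grp_def)

lemma unitary_rows_orthonormal:
  "U \<in> unitary_grp n \<Longrightarrow> i < n \<Longrightarrow> j < n \<Longrightarrow>
     (\<Sum>k<n. U $$ (i,k) * cnj (U $$ (j,k))) = (if i = j then 1 else 0)"
  by (simp add: unitary_grp_iff_orthonormal_rows)

lemma unitary_grpI: "U \<in> carrier_mat n n \<Longrightarrow> U * ctrans U = 1\<^sub>m n \<Longrightarrow> U \<in> unitary_grp n"
  by (simp add: unitary_grp_def)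

lemma unitary_mult_ctrans: "U \<in> unitary_grp n \<Longrightarrow> U * ctrans U = 1\<^sub>m n"
  by (simp add: unitary_grp_def)

lemma ctrans_mult_unitary: "U \<in> unitary_grp n \<Longrightarrow> ctrans U * U = 1\<^sub>m n"
  by (rule mat_mult_left_right_inverse) (auto simp: unitary_grp_def)

lemma unitary_grp_carrier [simp, intro]: "U \<in> unitary_grp n \<Longrightarrow> U \<in> carrier_mat n n"
  by (simp add: unitary_grp_def)

lemma unitary_row_norm:
  assumes "U \<in> unitary_grp n" "i < n"
  shows "(\<Sum>k<n. (cmod (U $$ (i,k)))\<^sup>2) = 1"
proof -
  have "complex_of_real (\<Sum>k<n. (cmod (U $$ (i,k)))\<^sup>2) = (\<Sum>k<n. U $$ (i,k) * cnj (U $$ (i,k)))"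
    by (simp flip: complex_norm_square)
  also have "\<dots> = 1" using assms by (simp add: unitary_rows_orthonormal)
  finally show ?thesis by (simp only: of_real_eq_1_iff)
qed

lemma unitary_one [simp]: "1\<^sub>m n \<in> unitary_grp n"
proof (rule unitary_grpI)
  have "ctrans (1\<^sub>m n) = 1\<^sub>m n" by (auto simp: ctrans_def)
  then show "1\<^sub>m n * ctrans (1\<^sub>m n) = 1\<^sub>m n" by simp
qed simp

lemma unitary_ctrans [simp]: "U \<in> unitary_grp n \<Longrightarrow> ctrans U \<in> unitary_grp n"
  by (intro unitary_grpI) (simp_all add: ctrans_mult_unitary)

lemma mult_unitary_cancel_right:
  assumes "A \<in> carrier_mat m n" "U \<in> unitary_grp n"
  shows "A * U * ctrans U = A" "A * ctrans U * U = A"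
  using assms
  by (simp_all add: assoc_mult_mat[of _ m n _ n _ n] unitary_mult_ctrans ctrans_mult_unitary
      right_mult_one_mat[of _ m n])

lemma unitary_mult [simp]:
  assumes U: "U \<in> unitary_grp n" and V: "V \<in> unitary_grp n"
  shows "U * V \<in> unitary_grp n"
proof -
  have "U * V * ctrans (U * V) = U * V * (ctrans V * ctrans U)"
    using U V by (simp add: ctrans_mult[of _ n n _ n])
  also have "\<dots> = U * V * ctrans V * ctrans U"
    using U V by (intro assoc_mult_mat[of _ n n _ n _ n, symmetric] mult_carrier_mat[of _ n n]) auto
  also have "\<dots> = 1\<^sub>m n"
    unfolding mult_unitary_cancel_right(1)[OF unitary_grp_carrier[OF U] V]
    using U by (rule unitary_mult_ctrans)
  finally show ?thesis using U V by (intro unitary_grpI mult_carrier_mat[of _ n n]) auto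
qed

lemma block_unitary_unitary: "U \<in> block_unitary n blk \<Longrightarrow> U \<in> unitary_grp n"
  by (simp add: block_unitary_def)

lemma block_unitary_one: "1\<^sub>m n \<in> block_unitary n blk"
  by (auto simp: block_unitary_def)

lemma block_unitary_mult:
  assumes U: "U \<in> block_unitary n blk" and V: "V \<in> block_unitary n blk"
  shows "U * V \<in> block_unitary n blk"
proof -
  have "(U * V) $$ (i,j) = 0" if ij: "i < n" "j < n" "blk i \<noteq> blk j" for i j
  proof -
    have "U $$ (i,k) * V $$ (k,j) = 0" if "k < n" for k
      using U V ij that by (cases "blk i = blk k") (auto simp: block_unitary_def)
    then show ?thesis
      using U V ij by (simp add: block_unitary_def mult_mat_entry[of _ n n _ n] sum.neutral)
  qed
  with U V show ?thesis by (simp add: block_unitary_def)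
qed

lemma block_unitary_ctrans:
  assumes "U \<in> block_unitary n blk"
  shows "ctrans U \<in> block_unitary n blk"
  using assms by (auto simp: block_unitary_def ctrans_entry[of U n n])

lemma L_grp_unitary: "x \<in> L_grp n2 n3 \<Longrightarrow> x \<in> unitary_grp (1 + n2 + n3)"
  by (simp add: L_grp_def block_unitary_def)

lemma H_grp_unitary: "h \<in> H_grp p q \<Longrightarrow> h \<in> unitary_grp (p + q)"
  by (simp add: H_grp_def block_unitary_def)

lemma L_grp_ctrans: "x \<in> L_grp n2 n3 \<Longrightarrow> ctrans x \<in> L_grp n2 n3"
  by (simp add: L_grp_def block_unitary_ctrans)

lemma H_grp_ctrans: "h \<in> H_grp p q \<Longrightarrow> ctrans h \<in> H_grp p q"
  by (simp add: H_grp_def block_unitary_ctrans)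

lemma H_grp_mult: "g \<in> H_grp p q \<Longrightarrow> h \<in> H_grp p q \<Longrightarrow> g * h \<in> H_grp p q"
  by (simp add: H_grp_def block_unitary_mult)

definition fixes_coords :: "nat \<Rightarrow> nat set \<Rightarrow> complex mat \<Rightarrow> bool" where
  "fixes_coords n S A \<longleftrightarrow>
     (\<forall>i<n. \<forall>j<n. i \<in> S \<or> j \<in> S \<longrightarrow> A $$ (i,j) = (if i = j then 1 else 0))"

lemma fixes_coords_subset: "fixes_coords n T A \<Longrightarrow> S \<inter> {..<n} \<subseteq> T \<Longrightarrow> fixes_coords n S A"
  unfolding fixes_coords_def by blast

lemma fixes_coords_mult_entry:
  assumes A: "A \<in> carrier_mat n n" "fixes_coords n S A"
    and B: "B \<in> carrier_mat n n" "fixes_coords n (- S) B"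
    and ij: "i < n" "j < n"
  shows "(A * B) $$ (i,j) = A $$ (i,j) + B $$ (i,j) - (if i = j then 1 else 0)"
proof -
  define \<delta> :: "nat \<Rightarrow> nat \<Rightarrow> complex" where "\<delta> a b = (if a = b then 1 else 0)" for a b
  have "(A $$ (i,k) - \<delta> i k) * (B $$ (k,j) - \<delta> k j) = 0" if "k < n" for k
    using A(2) B(2) ij that by (cases "k \<in> S") (auto simp: fixes_coords_def \<delta>_def)
  then have "0 = (\<Sum>k<n. (A $$ (i,k) - \<delta> i k) * (B $$ (k,j) - \<delta> k j))"
    by (intro sum.neutral[symmetric]) blast
  also have "\<dots> = (\<Sum>k<n. A $$ (i,k) * B $$ (k,j) - (if k = j then A $$ (i,j) else 0)
      - (if k = i then B $$ (i,j) - \<delta> i j else 0))"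
    by (intro sum.cong) (auto simp: \<delta>_def algebra_simps)
  also have "\<dots> = (A * B) $$ (i,j) - A $$ (i,j) - (B $$ (i,j) - \<delta> i j)"
    using ij by (simp add: sum_subtractf mult_mat_entry[OF A(1) B(1)])
  finally show ?thesis by (simp add: \<delta>_def algebra_simps)
qed

lemma fixes_coords_commute:
  assumes A: "A \<in> carrier_mat n n" "fixes_coords n S A"
    and B: "B \<in> carrier_mat n n" "fixes_coords n (- S) B"
  shows "A * B = B * A"
proof (rule eq_matI)
  fix i j assume "i < dim_row (B * A)" "j < dim_col (B * A)"
  with A B have ij: "i < n" "j < n" by auto
  have "fixes_coords n (- (- S)) A" using A(2) by simp
  then show "(A * B) $$ (i,j) = (B * A) $$ (i,j)"
    using fixes_coords_mult_entry[OF A B ij] fixes_coords_mult_entry[OF B A(1) _ ij] by simp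
qed (use A B in auto)

lemma block_unitary_if_fixes_coords:
  assumes U: "U \<in> unitary_grp n" "fixes_coords n (- S) U"
    and S: "\<And>i j. i \<in> S \<Longrightarrow> j \<in> S \<Longrightarrow> blk i = blk j"
  shows "U \<in> block_unitary n blk"
proof -
  have "U $$ (i,j) = 0" if "i < n" "j < n" "blk i \<noteq> blk j" for i j
  proof -
    have "i \<in> - S \<or> j \<in> - S" "i \<noteq> j" using that(3) S by auto
    then show ?thesis using U(2) that by (simp add: fixes_coords_def)
  qed
  with U(1) show ?thesis by (simp add: block_unitary_def)
qed

section \<open>Transitivity of the unitary group on spheres\<close>

definition rank_one_update :: "nat \<Rightarrow> complex \<Rightarrow> (nat \<Rightarrow> complex) \<Rightarrow> complex mat" where
  "rank_one_update n c v = mat n n (\<lambda>(i,j). (if i = j then 1 else 0) - c * v i * cnj (v j))"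

lemma rank_one_update_unitary:
  assumes coeff: "c * cnj c * (\<Sum>i<n. v i * cnj (v i)) = c + cnj c"
  shows "rank_one_update n c v \<in> unitary_grp n"
  unfolding unitary_grp_iff_orthonormal_rows
proof (intro conjI allI impI)
  fix i j assume ij: "i < n" "j < n"
  let ?U = "rank_one_update n c v" and ?V = "\<Sum>l<n. v l * cnj (v l)"
  have "(\<Sum>l<n. ?U $$ (i,l) * cnj (?U $$ (j,l))) =
      (\<Sum>l<n. (if l = i then if i = j then 1 else 0 else 0)
        - (if l = i then cnj c * v i * cnj (v j) else 0)
        - (if l = j then c * v i * cnj (v j) else 0)
        + v i * cnj (v j) * (c * cnj c) * (v l * cnj (v l)))"
    using ij by (intro sum.cong) (auto simp: rank_one_update_def algebra_simps)
  also have "\<dots> = (if i = j then 1 else 0) - (c + cnj c) * v i * cnj (v j)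
      + v i * cnj (v j) * (c * cnj c * ?V)"
    unfolding sum.distrib sum_subtractf sum_distrib_left[symmetric]
    using ij by (simp add: algebra_simps)
  also have "\<dots> = (if i = j then 1 else 0)" unfolding coeff by (simp add: algebra_simps)
  finally show "(\<Sum>l<n. ?U $$ (i,l) * cnj (?U $$ (j,l))) = (if i = j then 1 else 0)" .
qed (simp add: rank_one_update_def)

text \<open>The matrix is \<open>1 - v v\<^sup>* / w\<close> with \<open>v = (x - y)\<^sup>*\<close> and \<open>w = x v\<close>. If \<open>w = 0\<close> then \<open>x = y\<close>, and
  the junk value \<open>1 / 0 = 0\<close> makes it the identity.\<close>

lemma unitary_maps_row_to_equal_norm:
  fixes x y :: "nat \<Rightarrow> complex"
  assumes norm: "(\<Sum>i<n. (cmod (x i))\<^sup>2) = (\<Sum>i<n. (cmod (y i))\<^sup>2)"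
  shows "\<exists>U \<in> unitary_grp n. fixes_coords n {i. x i = y i} U \<and>
    (\<forall>j<n. (\<Sum>i<n. x i * U $$ (i,j)) = y j)"
proof -
  define v where "v i = cnj (x i - y i)" for i
  define w where "w = (\<Sum>i<n. x i * v i)"
  let ?U = "rank_one_update n (1 / w) v"
  have "(\<Sum>i<n. x i * cnj (x i)) = (\<Sum>i<n. y i * cnj (y i))"
    using arg_cong[OF norm, of complex_of_real] by (simp flip: complex_norm_square)
  moreover have "w + cnj w = (\<Sum>i<n. v i * cnj (v i) + x i * cnj (x i) - y i * cnj (y i))"
    unfolding w_def cnj_sum sum.distrib[symmetric]
    by (intro sum.cong) (auto simp: v_def algebra_simps)
  ultimately have vv: "(\<Sum>i<n. v i * cnj (v i)) = w + cnj w"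
    by (simp add: sum.distrib sum_subtractf)
  have v_zero: "v j = 0" if "w = 0" "j < n" for j
  proof -
    have "complex_of_real (\<Sum>i<n. (cmod (v i))\<^sup>2) = 0"
      using vv that(1) by (simp flip: complex_norm_square)
    then have "(\<Sum>i<n. (cmod (v i))\<^sup>2) = 0" by (simp only: of_real_eq_0_iff)
    then show ?thesis using that(2) by (simp add: sum_nonneg_eq_0_iff)
  qed
  have "?U \<in> unitary_grp n"
    by (rule rank_one_update_unitary) (cases "w = 0"; simp add: vv field_simps)
  moreover have "fixes_coords n {i. x i = y i} ?U"
    by (auto simp: fixes_coords_def rank_one_update_def v_def)
  moreover have "(\<Sum>i<n. x i * ?U $$ (i,j)) = y j" if j: "j < n" for j
  proof -
    have "(\<Sum>i<n. x i * ?U $$ (i,j)) =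
        (\<Sum>i<n. (if i = j then x j else 0) - 1 / w * cnj (v j) * (x i * v i))"
      using j by (intro sum.cong) (auto simp: rank_one_update_def algebra_simps)
    also have "\<dots> = x j - 1 / w * cnj (v j) * w"
      unfolding sum_subtractf sum_distrib_left[symmetric] w_def[symmetric] using j by simp
    also have "\<dots> = x j - cnj (v j)" using v_zero[OF _ j] by (cases "w = 0") auto
    finally show ?thesis by (simp add: v_def)
  qed
  ultimately show ?thesis by blast
qed

lemma unitary_concentrates_row:
  fixes x :: "nat \<Rightarrow> complex"
  assumes S: "S \<subseteq> {..<n}" and k: "k \<in> S"
  shows "\<exists>U \<in> unitary_grp n. fixes_coords n (- S) U \<and> (\<forall>j<n. (\<Sum>i<n. x i * U $$ (i,j)) =
    (if j \<in> S then if j = k then of_real (sqrt (\<Sum>i\<in>S. (cmod (x i))\<^sup>2)) else 0 else x j))"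
proof -
  define \<rho> where "\<rho> = sqrt (\<Sum>i\<in>S. (cmod (x i))\<^sup>2)"
  define y where "y j = (if j \<in> S then if j = k then complex_of_real \<rho> else 0 else x j)" for j
  have "finite S" using S finite_subset by blast
  have "(\<Sum>i\<in>S. (cmod (y i))\<^sup>2) = (\<Sum>i\<in>S. if i = k then \<rho>\<^sup>2 else 0)"
    by (intro sum.cong) (auto simp: y_def)
  also have "\<dots> = (\<Sum>i\<in>S. (cmod (x i))\<^sup>2)"
    using \<open>finite S\<close> k by (simp add: \<rho>_def sum_nonneg)
  finally have "(\<Sum>i<n. (cmod (x i))\<^sup>2) = (\<Sum>i<n. (cmod (y i))\<^sup>2)"
    by (simp add: sum.subset_diff[OF S] y_def)
  from unitary_maps_row_to_equal_norm[OF this] obtain U where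
    U: "U \<in> unitary_grp n" "fixes_coords n {i. x i = y i} U" "\<forall>j<n. (\<Sum>i<n. x i * U $$ (i,j)) = y j"
    by blast
  have "fixes_coords n (- S) U" by (rule fixes_coords_subset[OF U(2)]) (auto simp: y_def)
  with U(1,3) show ?thesis unfolding y_def \<rho>_def by blast
qed

lemma unitary_real_two_entry_row:
  assumes g: "g \<in> unitary_grp n" and "i < n" "k < n" "l < n" "k \<noteq> l"
    and row: "\<And>j. j < n \<Longrightarrow> g $$ (i,j) =
      (if j = k then of_real a else if j = l then of_real b else 0)"
  obtains \<theta> where "a = cos \<theta>" "b = sin \<theta>"
proof -
  have "1 = (\<Sum>j<n. (cmod (g $$ (i,j)))\<^sup>2)"
    using unitary_row_norm[OF g \<open>i < n\<close>] ..
  also have "\<dots> = (\<Sum>j<n. (if j = k then a\<^sup>2 else 0) + (if j = l then b\<^sup>2 else 0))"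
    using \<open>k \<noteq> l\<close> by (intro sum.cong) (auto simp: row)
  also have "\<dots> = a\<^sup>2 + b\<^sup>2"
    using \<open>k < n\<close> \<open>l < n\<close> by (simp add: sum.distrib)
  finally show thesis using sincos_total_2pi that by metis
qed

lemma H_grp_reduces_first_row:
  assumes g: "g \<in> unitary_grp (p + q)" and p: "0 < p" and q: "0 < q"
  obtains h \<theta> where "h \<in> H_grp p q"
    "\<And>j. j < p + q \<Longrightarrow> (g * h) $$ (0,j) =
       (if j = 0 then of_real (cos \<theta>) else if j = p + q - 1 then of_real (sin \<theta>) else 0)"
proof -
  define n where "n = p + q"
  obtain U a where U: "U \<in> unitary_grp n" "fixes_coords n (- {..<p}) U"
    and row_U: "\<And>j. j < n \<Longrightarrow> (\<Sum>i<n. g $$ (0,i) * U $$ (i,j)) =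
      (if j < p then if j = 0 then complex_of_real a else 0 else g $$ (0,j))"
    using unitary_concentrates_row[of "{..<p}" n 0 "\<lambda>i. g $$ (0,i)"] p by (auto simp: n_def)
  have "{p..<n} \<subseteq> {..<n}" "n - 1 \<in> {p..<n}" using q by (auto simp: n_def)
  from unitary_concentrates_row[OF this, of "\<lambda>i. (g * U) $$ (0,i)"]
  obtain V b where V: "V \<in> unitary_grp n" "fixes_coords n (- {p..<n}) V"
    and row_V: "\<And>j. j < n \<Longrightarrow> (\<Sum>i<n. (g * U) $$ (0,i) * V $$ (i,j)) =
      (if j \<in> {p..<n} then if j = n - 1 then complex_of_real b else 0 else (g * U) $$ (0,j))"
    by blast
  have row: "(g * (U * V)) $$ (0,j) =
      (if j = 0 then of_real a else if j = n - 1 then of_real b else 0)" if "j < n" for j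
  proof -
    have "g * (U * V) = g * U * V"
      using g U V by (simp add: assoc_mult_mat[of _ n n _ n _ n] flip: n_def)
    then have "(g * (U * V)) $$ (0,j) = (\<Sum>i<n. (g * U) $$ (0,i) * V $$ (i,j))"
      using g U V that by (simp add: mult_mat_entry[of _ n n _ n] flip: n_def)
    moreover have "(g * U) $$ (0,j) = (\<Sum>i<n. g $$ (0,i) * U $$ (i,j))"
      using g U that by (simp add: mult_mat_entry[of _ n n _ n] flip: n_def)
    ultimately show ?thesis using row_U row_V that p q by (auto simp: n_def)
  qed
  have "g * (U * V) \<in> unitary_grp n" using g U V by (simp add: n_def)
  then obtain \<theta> where "a = cos \<theta>" "b = sin \<theta>"
    using unitary_real_two_entry_row[of _ n, OF _ _ _ _ _ row] p q by (auto simp: n_def)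
  moreover have "U * V \<in> H_grp p q"
    unfolding H_grp_def n_def[symmetric]
    by (intro block_unitary_mult block_unitary_if_fixes_coords[OF U]
        block_unitary_if_fixes_coords[OF V]) auto
  ultimately show thesis using row by (intro that[of "U * V" \<theta>]) (simp_all add: n_def)
qed

section \<open>Rotations in mirrored coordinate planes\<close>

text \<open>The mirror \<open>i \<mapsto> c - i\<close> pairs the coordinates, and an angle vector turns the plane of the
  coordinates \<open>i\<close> and \<open>c - i\<close> by the angle \<open>t i = - t (c - i)\<close>; a coordinate without a partner
  below \<open>n\<close> has angle \<open>0\<close>. With indices starting at \<open>0\<close>, the case \<open>c = n - 1\<close> gives \<open>B'\<close> and \<open>c = n\<close> gives
  \<open>B''\<close>. Only the planes of the coordinates \<open>i < k\<close> are turned.\<close>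

definition mirror_angles :: "nat \<Rightarrow> nat \<Rightarrow> nat \<Rightarrow> (nat \<Rightarrow> real) set" where
  "mirror_angles n c k = {t. (\<forall>i j. i + j = c \<longrightarrow> t j = - t i) \<and>
     (\<forall>i. n \<le> i \<or> c < i \<longrightarrow> t i = 0) \<and> (\<forall>i. k \<le> i \<and> i + k \<le> c \<longrightarrow> t i = 0)}"

definition mirror_generator :: "nat \<Rightarrow> nat \<Rightarrow> (nat \<Rightarrow> real) \<Rightarrow> complex mat" where
  "mirror_generator n c t = mat n n (\<lambda>(i,j). if i + j = c then of_real (t i) else 0)"

definition mirror_rotation :: "nat \<Rightarrow> nat \<Rightarrow> (nat \<Rightarrow> real) \<Rightarrow> complex mat" where
  "mirror_rotation n c t = mat n n (\<lambda>(i,j).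
     (if i = j then of_real (cos (t i)) else 0) + (if i + j = c then of_real (sin (t i)) else 0))"

definition mirror_torus :: "nat \<Rightarrow> nat \<Rightarrow> nat \<Rightarrow> complex mat set" where
  "mirror_torus n c k = mirror_rotation n c ` mirror_angles n c k"

lemma mirror_generator_carrier [simp]: "mirror_generator n c t \<in> carrier_mat n n"
  by (simp add: mirror_generator_def)

lemma mirror_rotation_carrier [simp]: "mirror_rotation n c t \<in> carrier_mat n n"
  by (simp add: mirror_rotation_def)

lemma mirror_generator_entry [simp]:
  "i < n \<Longrightarrow> j < n \<Longrightarrow> mirror_generator n c t $$ (i,j) = (if i + j = c then of_real (t i) else 0)"
  by (simp add: mirror_generator_def)

lemma mirror_rotation_entry [simp]:
  "i < n \<Longrightarrow> j < n \<Longrightarrow> mirror_rotation n c t $$ (i,j) =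
     (if i = j then of_real (cos (t i)) else 0) + (if i + j = c then of_real (sin (t i)) else 0)"
  by (simp add: mirror_rotation_def)

lemma mirror_angles_partner:
  assumes "t \<in> mirror_angles n c k" "t i \<noteq> 0"
  shows "i \<le> c" "c - i < n" "t (c - i) = - t i"
proof -
  show "i \<le> c" using assms by (force simp: mirror_angles_def not_less[symmetric])
  then have "i + (c - i) = c" by simp
  then show opposite: "t (c - i) = - t i" using assms(1) unfolding mirror_angles_def by blast
  show "c - i < n" using assms opposite by (force simp: mirror_angles_def not_less[symmetric])
qed

lemma mirror_angles_uminus: "t \<in> mirror_angles n c k \<Longrightarrow> (\<lambda>i. - t i) \<in> mirror_angles n c k"
  by (auto simp: mirror_angles_def)

lemma mirror_angles_add:
  "t \<in> mirror_angles n c k \<Longrightarrow> u \<in> mirror_angles n c k \<Longrightarrow> (\<lambda>i. t i + u i) \<in> mirror_angles n c k"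
  by (auto simp: mirror_angles_def)

lemma sum_mirror_row:
  fixes f :: "nat \<Rightarrow> complex"
  assumes t: "t \<in> mirror_angles n c k" and i: "i < n" and y: "t i = 0 \<Longrightarrow> y = 0"
  shows "(\<Sum>l<n. ((if i = l then x else 0) + (if i + l = c then y else 0)) * f l) =
    x * f i + y * f (c - i)"
proof -
  have "(\<Sum>l<n. ((if i = l then x else 0) + (if i + l = c then y else 0)) * f l) =
      (\<Sum>l<n. if l = i then x * f i else 0) + (\<Sum>l<n. if i + l = c then y * f (c - i) else 0)"
    unfolding sum.distrib[symmetric] by (intro sum.cong) (auto simp: algebra_simps)
  also have "(\<Sum>l<n. if i + l = c then y * f (c - i) else 0) = y * f (c - i)"
  proof (cases "t i = 0")
    case True
    then have "y = 0" by (rule y)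
    then show ?thesis by (simp cong: if_cong)
  next
    case False
    note partner = mirror_angles_partner[OF t this]
    then have "i + l = c \<longleftrightarrow> l = c - i" for l by auto
    then show ?thesis using partner by simp
  qed
  finally show ?thesis using i by simp
qed

lemma mirror_generator_power_entry:
  assumes t: "t \<in> mirror_angles n c k" and i: "i < n" and j: "j < n"
  shows "(mirror_generator n c t ^\<^sub>m r) $$ (i,j) =
    (if i = j then of_real (fact r * cos_coeff r * t i ^ r) else 0) +
    (if i + j = c then of_real (fact r * sin_coeff r * t i ^ r) else 0)"
  using j
proof (induction r arbitrary: j)
  case 0
  then show ?case using i by (simp add: mirror_generator_def cos_coeff_def sin_coeff_def)
next
  case (Suc r)
  let ?A = "mirror_generator n c t"
  define a where "a = fact r * cos_coeff r * t i ^ r"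
  define b where "b = fact r * sin_coeff r * t i ^ r"
  have Suc_coeffs: "fact (Suc r) * cos_coeff (Suc r) * t i ^ Suc r = - (b * t i)"
    "fact (Suc r) * sin_coeff (Suc r) * t i ^ Suc r = a * t i"
    by (simp_all add: a_def b_def cos_coeff_Suc sin_coeff_Suc field_simps del: of_nat_Suc)
  have "b = 0" if "t i = 0" using that by (cases r) (simp_all add: b_def sin_coeff_def)
  have "(?A ^\<^sub>m Suc r) $$ (i,j) = (\<Sum>l<n. (?A ^\<^sub>m r) $$ (i,l) * ?A $$ (l,j))"
    using i Suc.prems by (simp add: mult_mat_entry[of _ n n _ n] pow_carrier_mat[of _ n])
  also have "\<dots> = (\<Sum>l<n. ((if i = l then of_real a else 0) + (if i + l = c then of_real b else 0))
      * ?A $$ (l,j))"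
    using Suc.IH by (intro sum.cong) (auto simp: a_def b_def)
  also have "\<dots> = of_real a * ?A $$ (i,j) + of_real b * ?A $$ (c - i,j)"
    using \<open>t i = 0 \<Longrightarrow> b = 0\<close> by (intro sum_mirror_row[OF t i]) simp
  also have "\<dots> = (if i = j then of_real (- (b * t i)) else 0) +
      (if i + j = c then of_real (a * t i) else 0)"
  proof (cases "t i = 0")
    case True
    then show ?thesis using i Suc.prems \<open>t i = 0 \<Longrightarrow> b = 0\<close> by simp
  next
    case False
    note partner = mirror_angles_partner[OF t this]
    then have "c - i + j = c \<longleftrightarrow> i = j" by auto
    then show ?thesis using partner i Suc.prems by auto
  qed
  finally show ?case unfolding Suc_coeffs .
qed

lemma mexp_mirror_generator:
  assumes t: "t \<in> mirror_angles n c k"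
  shows "mexp (mirror_generator n c t) = mirror_rotation n c t"
proof (rule eq_matI)
  let ?A = "mirror_generator n c t"
  fix i j assume "i < dim_row (mirror_rotation n c t)" "j < dim_col (mirror_rotation n c t)"
  then have ij: "i < n" "j < n" by (auto simp: mirror_rotation_def)
  define cos_term where "cos_term r = complex_of_real (cos_coeff r * t i ^ r)" for r
  define sin_term where "sin_term r = complex_of_real (sin_coeff r * t i ^ r)" for r
  have "cos_term sums of_real (cos (t i))"
    unfolding cos_term_def using cos_converges[of "t i"] by (intro sums_of_real) simp
  moreover have "sin_term sums of_real (sin (t i))"
    unfolding sin_term_def using sin_converges[of "t i"] by (intro sums_of_real) simp
  ultimately have "(\<lambda>r. (if i = j then cos_term r else 0) + (if i + j = c then sin_term r else 0))
      sums mirror_rotation n c t $$ (i,j)"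
    using ij by (auto intro!: sums_add)
  moreover have "(?A ^\<^sub>m r) $$ (i,j) / of_nat (fact r) =
      (if i = j then cos_term r else 0) + (if i + j = c then sin_term r else 0)" for r
    by (simp add: mirror_generator_power_entry[OF t ij] cos_term_def sin_term_def add_divide_distrib)
  ultimately show "mexp ?A $$ (i,j) = mirror_rotation n c t $$ (i,j)"
    using ij by (simp add: mexp_def sums_iff mirror_generator_def)
qed (simp_all add: mexp_def mirror_generator_def mirror_rotation_def)

lemma mexp_image_mirror_generator:
  "mexp ` mirror_generator n c ` mirror_angles n c k = mirror_torus n c k"
  by (simp add: mirror_torus_def image_image mexp_mirror_generator cong: image_cong)

lemma mirror_rotation_mult:
  assumes t: "t \<in> mirror_angles n c k" and u: "u \<in> mirror_angles n c k"
  shows "mirror_rotation n c t * mirror_rotation n c u = mirror_rotation n c (\<lambda>i. t i + u i)"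
    (is "?T * ?U = ?TU")
proof (rule eq_matI)
  fix i j assume "i < dim_row ?TU" "j < dim_col ?TU"
  then have ij: "i < n" "j < n" by (auto simp: mirror_rotation_def)
  have "(?T * ?U) $$ (i,j) = (\<Sum>l<n. ((if i = l then of_real (cos (t i)) else 0) +
      (if i + l = c then of_real (sin (t i)) else 0)) * ?U $$ (l,j))"
    using ij by (simp add: mult_mat_entry[of _ n n _ n])
  also have "\<dots> = of_real (cos (t i)) * ?U $$ (i,j) + of_real (sin (t i)) * ?U $$ (c - i,j)"
    by (intro sum_mirror_row[OF t ij(1)]) simp
  also have "\<dots> = ?TU $$ (i,j)"
  proof (cases "t i = 0")
    case True
    then show ?thesis using ij by (cases "i = j") auto
  next
    case False
    note partner = mirror_angles_partner[OF t this]
    then have "i + (c - i) = c" by simp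
    then have "u (c - i) = - u i" using u unfolding mirror_angles_def by blast
    moreover have "c - i = j \<longleftrightarrow> i + j = c" "c - i + j = c \<longleftrightarrow> i = j" using partner by auto
    ultimately show ?thesis
      using partner ij by (auto simp: cos_add sin_add algebra_simps)
  qed
  finally show "(?T * ?U) $$ (i,j) = ?TU $$ (i,j)" .
qed (simp_all add: mirror_rotation_def)

lemma ctrans_mirror_rotation:
  assumes t: "t \<in> mirror_angles n c k"
  shows "ctrans (mirror_rotation n c t) = mirror_rotation n c (\<lambda>i. - t i)"
proof (rule eq_matI)
  fix i j
  assume "i < dim_row (mirror_rotation n c (\<lambda>i. - t i))" "j < dim_col (mirror_rotation n c (\<lambda>i. - t i))"
  then have ij: "i < n" "j < n" by (auto simp: mirror_rotation_def)
  have "t j = - t i" if "i + j = c" using t that by (auto simp: mirror_angles_def)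
  then show "ctrans (mirror_rotation n c t) $$ (i,j) = mirror_rotation n c (\<lambda>i. - t i) $$ (i,j)"
    using ij by (auto simp: ctrans_entry[of _ n n] add.commute)
qed (simp_all add: ctrans_def mirror_rotation_def)

lemma mirror_rotation_zero: "mirror_rotation n c (\<lambda>i. 0) = 1\<^sub>m n"
  by (auto simp: mirror_rotation_def)

lemma mirror_torus_one: "1\<^sub>m n \<in> mirror_torus n c k"
proof -
  have "(\<lambda>i. 0) \<in> mirror_angles n c k" by (simp add: mirror_angles_def)
  then show ?thesis unfolding mirror_torus_def using mirror_rotation_zero by (metis imageI)
qed

lemma mirror_torus_unitary:
  assumes "z \<in> mirror_torus n c k"
  shows "z \<in> unitary_grp n"
proof -
  obtain t where z: "z = mirror_rotation n c t" and t: "t \<in> mirror_angles n c k"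
    using assms by (auto simp: mirror_torus_def)
  have "z * ctrans z = mirror_rotation n c (\<lambda>i. t i + - t i)"
    unfolding z ctrans_mirror_rotation[OF t]
    by (rule mirror_rotation_mult[OF t mirror_angles_uminus[OF t]])
  then show ?thesis by (intro unitary_grpI) (simp_all add: z mirror_rotation_zero)
qed

lemma mirror_torus_ctrans: "z \<in> mirror_torus n c k \<Longrightarrow> ctrans z \<in> mirror_torus n c k"
  by (auto simp: mirror_torus_def ctrans_mirror_rotation mirror_angles_uminus)

lemma mirror_torus_mult:
  "y \<in> mirror_torus n c k \<Longrightarrow> z \<in> mirror_torus n c k \<Longrightarrow> y * z \<in> mirror_torus n c k"
  by (auto simp: mirror_torus_def mirror_rotation_mult mirror_angles_add)

lemma mirror_torus_mono: "k \<le> k' \<Longrightarrow> mirror_torus n c k \<subseteq> mirror_torus n c k'"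
  by (auto simp: mirror_torus_def mirror_angles_def)

lemma mirror_torus_fixes_coords:
  assumes "z \<in> mirror_torus n c k"
  shows "fixes_coords n {i. k \<le> i \<and> i + k \<le> c} z"
proof -
  obtain t where z: "z = mirror_rotation n c t" and t: "t \<in> mirror_angles n c k"
    using assms by (auto simp: mirror_torus_def)
  have zero: "t i = 0" if "k \<le> i" "i + k \<le> c" for i
    using t that by (simp add: mirror_angles_def)
  have zero_partner: "t i = 0" if "i + j = c" "k \<le> j" "j + k \<le> c" for i j
  proof -
    have "t j = - t i" using t that(1) by (simp add: mirror_angles_def)
    with zero[OF that(2,3)] show ?thesis by simp
  qed
  show ?thesis unfolding fixes_coords_def
  proof (intro allI impI)
    fix i j assume ij: "i < n" "j < n"
      and "i \<in> {i. k \<le> i \<and> i + k \<le> c} \<or> j \<in> {i. k \<le> i \<and> i + k \<le> c}"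
    then have "t i = 0 \<or> i \<noteq> j \<and> i + j \<noteq> c" using zero zero_partner by blast
    with ij show "z $$ (i,j) = (if i = j then 1 else 0)" by (auto simp: z)
  qed
qed

lemma sum_mirrored_Eunits:
  fixes u :: "nat \<Rightarrow> real"
  assumes k: "2 * k \<le> Suc c" and ab: "a < n" "b < n"
  shows "(\<Sum>i<k. complex_of_real (u i) *
      (Eunit n (Suc i) (Suc (c - i)) - Eunit n (Suc (c - i)) (Suc i)) $$ (a,b)) =
    (if a + b = c then of_real (if a < k then u a else if b < k then - u b else 0) else 0)"
proof -
  have "(\<Sum>i<k. complex_of_real (u i) *
      (Eunit n (Suc i) (Suc (c - i)) - Eunit n (Suc (c - i)) (Suc i)) $$ (a,b)) =
    (\<Sum>i<k. (if i = a then if a + b = c then of_real (u a) else 0 else 0)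
      - (if i = b then if a + b = c then of_real (u b) else 0 else 0))"
  proof (intro sum.cong refl)
    fix i assume "i \<in> {..<k}"
    then have "a = i \<and> b = c - i \<longleftrightarrow> i = a \<and> a + b = c" "a = c - i \<and> b = i \<longleftrightarrow> i = b \<and> a + b = c"
      using k by auto
    then show "complex_of_real (u i) *
        (Eunit n (Suc i) (Suc (c - i)) - Eunit n (Suc (c - i)) (Suc i)) $$ (a,b) =
      (if i = a then if a + b = c then of_real (u a) else 0 else 0)
        - (if i = b then if a + b = c then of_real (u b) else 0 else 0)"
      using ab by (auto simp: Eunit_def)
  qed
  also have "\<dots> =
      (if a + b = c then of_real (if a < k then u a else if b < k then - u b else 0) else 0)"
    using k by (auto simp: sum_subtractf)
  finally show ?thesis .
qed

lemma span_mirrored_Eunits: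
  assumes k: "2 * k \<le> Suc c"
  shows "range (\<lambda>u :: nat \<Rightarrow> real. mat n n (\<lambda>ab. \<Sum>i<k. complex_of_real (u i) *
      (Eunit n (Suc i) (Suc (c - i)) - Eunit n (Suc (c - i)) (Suc i)) $$ ab)) =
    mirror_generator n c ` mirror_angles n c k"
    (is "range ?span = _")
proof (intro equalityI subsetI)
  fix A assume "A \<in> range ?span"
  then obtain u :: "nat \<Rightarrow> real" where A: "A = ?span u" by blast
  define t where "t a = (if a < n \<and> a \<le> c \<and> c - a < n
    then if a < k then u a else if c - a < k then - u (c - a) else 0 else 0)" for a
  have "A = mirror_generator n c t"
    unfolding A by (rule eq_matI) (auto simp: sum_mirrored_Eunits[OF k] mirror_generator_def t_def)
  moreover have "t \<in> mirror_angles n c k" using k by (auto simp: mirror_angles_def t_def)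
  ultimately show "A \<in> mirror_generator n c ` mirror_angles n c k" by blast
next
  fix A assume "A \<in> mirror_generator n c ` mirror_angles n c k"
  then obtain t where A: "A = mirror_generator n c t" and t: "t \<in> mirror_angles n c k" by blast
  have "t a = (if a < k then t a else if b < k then - t b else 0)" if "a + b = c" for a b
  proof -
    have "t b = - t a" using t that by (simp add: mirror_angles_def)
    moreover have "t a = 0" if "k \<le> a" "k \<le> b"
      using t that \<open>a + b = c\<close> by (simp add: mirror_angles_def)
    ultimately show ?thesis by auto
  qed
  then have "A = ?span t"
    unfolding A by (intro eq_matI) (auto simp: sum_mirrored_Eunits[OF k] mirror_generator_def)
  then show "A \<in> range ?span" by blast
qed

lemma b1_eq_mirror_generators:
  assumes m: "2 * m \<le> n"
  shows "b1 n m = mirror_generator n (n - 1) ` mirror_angles n (n - 1) m"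
proof -
  let ?D = "\<lambda>i. Eunit n (Suc i) (Suc (n - 1 - i)) - Eunit n (Suc (n - 1 - i)) (Suc i)"
  let ?span = "\<lambda>u :: nat \<Rightarrow> real. mat n n (\<lambda>ab. \<Sum>i<m. complex_of_real (u i) * ?D i $$ ab)"
  define shift where "shift t i = t (Suc i)" for t :: "nat \<Rightarrow> real" and i
  have reindex: "(\<Sum>i\<in>{1..m}. complex_of_real (t i) * (Eunit n i (n+1-i) - Eunit n (n+1-i) i) $$ ab) =
      (\<Sum>i<m. of_real (shift t i) * ?D i $$ ab)" for t ab
    unfolding One_nat_def sum.atLeast1_atMost_eq shift_def
    using m by (intro sum.cong refl) (simp add: Suc_diff_Suc)
  have "b1 n m = ?span ` range shift" unfolding b1_def reindex by blast
  also have "range shift = UNIV"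
    by (rule surjI[of _ "\<lambda>u i. u (i - 1)"]) (simp add: shift_def fun_eq_iff)
  also have "range ?span = mirror_generator n (n - 1) ` mirror_angles n (n - 1) m"
    using m by (intro span_mirrored_Eunits) simp
  finally show ?thesis .
qed

text \<open>The span of the mirrored matrix units also has a generator for \<open>i = 0\<close>, which is
  \<open>E\<^bsub>1,n+1\<^esub> - E\<^bsub>n+1,1\<^esub> = 0\<close>.\<close>

lemma b2_eq_mirror_generators:
  assumes m: "2 * m < n"
  shows "b2 n m = mirror_generator n n ` mirror_angles n n (Suc m)"
proof -
  let ?D = "\<lambda>i. Eunit n (Suc i) (Suc (n - i)) - Eunit n (Suc (n - i)) (Suc i)"
  let ?span = "\<lambda>u :: nat \<Rightarrow> real. mat n n (\<lambda>ab. \<Sum>i<Suc m. complex_of_real (u i) * ?D i $$ ab)"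
  have "(\<Sum>i<Suc m. complex_of_real (t i) * ?D i $$ (a,b)) =
      (\<Sum>i\<in>{1..m}. of_real (t i) * (Eunit n (i+1) (n+1-i) - Eunit n (n+1-i) (i+1)) $$ (a,b))"
    if "a < n" "b < n" for t :: "nat \<Rightarrow> real" and a b
  proof -
    have "?D 0 $$ (a,b) = 0" using that by (auto simp: Eunit_def)
    then show ?thesis
      unfolding One_nat_def sum.lessThan_Suc_shift sum.atLeast1_atMost_eq
      using m by (simp add: Suc_diff_Suc Suc_diff_le)
  qed
  then have "mat n n (\<lambda>ab. \<Sum>i\<in>{1..m}. complex_of_real (t i) *
        (Eunit n (i+1) (n+1-i) - Eunit n (n+1-i) (i+1)) $$ ab) = ?span t" for t
    by (intro eq_matI) auto
  then have "b2 n m = range ?span" unfolding b2_def by auto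
  also have "\<dots> = mirror_generator n n ` mirror_angles n n (Suc m)"
    using m by (intro span_mirrored_Eunits) simp
  finally show ?thesis .
qed

section \<open>Embedding with reversed indices\<close>

text \<open>The indices are reversed so that the smaller double coset problem, in which the roles of
  the two subgroups are exchanged, is again in standard position.\<close>

definition reverse_embed :: "nat \<Rightarrow> complex mat \<Rightarrow> complex mat" where
  "reverse_embed N u = mat (Suc N) (Suc N)
     (\<lambda>(a,b). if a = 0 \<or> b = 0 then if a = b then 1 else 0 else u $$ (N - a, N - b))"

lemma reverse_embed_carrier [simp]: "reverse_embed N u \<in> carrier_mat (Suc N) (Suc N)"
  by (simp add: reverse_embed_def)

lemma reverse_embed_entry [simp]:
  "a < Suc N \<Longrightarrow> b < Suc N \<Longrightarrow> reverse_embed N u $$ (a,b) =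
     (if a = 0 \<or> b = 0 then if a = b then 1 else 0 else u $$ (N - a, N - b))"
  by (simp add: reverse_embed_def)

lemma reverse_embed_one: "reverse_embed N (1\<^sub>m N) = 1\<^sub>m (Suc N)"
  by (rule eq_matI) (auto simp: reverse_embed_def)

lemma reverse_embed_mult:
  assumes u: "u \<in> carrier_mat N N" and v: "v \<in> carrier_mat N N"
  shows "reverse_embed N (u * v) = reverse_embed N u * reverse_embed N v"
    (is "?E (u * v) = _")
proof (rule eq_matI)
  fix a b assume "a < dim_row (?E u * ?E v)" "b < dim_col (?E u * ?E v)"
  then have ab: "a < Suc N" "b < Suc N" by (auto simp: reverse_embed_def)
  have prod_entry: "(?E u * ?E v) $$ (a,b) =
      ?E u $$ (a,0) * ?E v $$ (0,b) + (\<Sum>k<N. ?E u $$ (a,Suc k) * ?E v $$ (Suc k,b))"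
    using ab by (simp add: mult_mat_entry[of _ "Suc N" "Suc N" _ "Suc N"] sum.lessThan_Suc_shift
        del: sum.lessThan_Suc reverse_embed_entry)
  show "?E (u * v) $$ (a,b) = (?E u * ?E v) $$ (a,b)"
  proof (cases "a = 0 \<or> b = 0")
    case True
    then show ?thesis unfolding prod_entry using ab by auto
  next
    case False
    have "(\<Sum>k<N. ?E u $$ (a,Suc k) * ?E v $$ (Suc k,b)) =
        (\<Sum>k<N. u $$ (N - a,N - Suc k) * v $$ (N - Suc k,N - b))"
      using ab False by (intro sum.cong) auto
    also have "\<dots> = (\<Sum>k<N. u $$ (N - a,k) * v $$ (k,N - b))"
      by (rule sum.nat_diff_reindex)
    also have "\<dots> = (u * v) $$ (N - a, N - b)"
      using ab False by (intro mult_mat_entry[OF u v, symmetric]) auto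
    finally show ?thesis unfolding prod_entry using ab False by simp
  qed
qed (auto simp: reverse_embed_def)

lemma ctrans_reverse_embed:
  assumes u: "u \<in> carrier_mat N N"
  shows "ctrans (reverse_embed N u) = reverse_embed N (ctrans u)"
proof (rule eq_matI)
  fix a b assume "a < dim_row (reverse_embed N (ctrans u))" "b < dim_col (reverse_embed N (ctrans u))"
  then have "a < Suc N" "b < Suc N" by (auto simp: reverse_embed_def)
  then show "ctrans (reverse_embed N u) $$ (a,b) = reverse_embed N (ctrans u) $$ (a,b)"
    using ctrans_entry[OF u, of "N - a" "N - b"] by (auto simp: ctrans_entry[of _ "Suc N" "Suc N"])
qed (auto simp: reverse_embed_def ctrans_def)

lemma reverse_embed_unitary:
  assumes u: "u \<in> unitary_grp N"
  shows "reverse_embed N u \<in> unitary_grp (Suc N)"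
proof (rule unitary_grpI)
  have "reverse_embed N u * ctrans (reverse_embed N u) = reverse_embed N (u * ctrans u)"
    using u by (simp add: ctrans_reverse_embed reverse_embed_mult)
  then show "reverse_embed N u * ctrans (reverse_embed N u) = 1\<^sub>m (Suc N)"
    by (simp add: unitary_mult_ctrans[OF u] reverse_embed_one)
qed simp

lemma reverse_embed_inject:
  assumes u: "u \<in> carrier_mat N N" and v: "v \<in> carrier_mat N N"
    and eq: "reverse_embed N u = reverse_embed N v"
  shows "u = v"
proof (rule eq_matI)
  fix i j assume "i < dim_row v" "j < dim_col v"
  then have "i < N" "j < N" using v by auto
  then show "u $$ (i,j) = v $$ (i,j)"
    using arg_cong[OF eq, of "\<lambda>A. A $$ (N - i, N - j)"] by simp
qed (use u v in auto)

lemma unitary_first_row_unit_vector: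
  assumes g: "g \<in> unitary_grp (Suc N)"
    and row: "\<And>j. j < Suc N \<Longrightarrow> g $$ (0,j) = (if j = 0 then 1 else 0)"
  obtains u where "u \<in> unitary_grp N" "g = reverse_embed N u"
proof -
  have col: "g $$ (i,0) = (if i = 0 then 1 else 0)" if "i < Suc N" for i
  proof -
    have "g $$ (i,0) = (\<Sum>k<Suc N. if k = 0 then g $$ (i,0) else 0)"
      by (simp del: sum.lessThan_Suc)
    also have "\<dots> = (\<Sum>k<Suc N. g $$ (i,k) * cnj (g $$ (0,k)))"
      using row by (intro sum.cong) auto
    also have "\<dots> = (if i = 0 then 1 else 0)"
      using unitary_rows_orthonormal[OF g that zero_less_Suc] .
    finally show ?thesis .
  qed
  define u where "u = mat N N (\<lambda>(i,j). g $$ (N - i, N - j))"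
  have u: "u \<in> carrier_mat N N" by (simp add: u_def)
  have gu: "g = reverse_embed N u"
  proof (rule eq_matI)
    fix i j assume "i < dim_row (reverse_embed N u)" "j < dim_col (reverse_embed N u)"
    then show "g $$ (i,j) = reverse_embed N u $$ (i,j)"
      using row[of j] col[of i] by (auto simp: reverse_embed_def u_def)
  qed (use unitary_grp_carrier[OF g] in \<open>auto simp: reverse_embed_def\<close>)
  have "reverse_embed N (u * ctrans u) = reverse_embed N (1\<^sub>m N)"
    using unitary_mult_ctrans[OF g] u
    by (simp add: gu reverse_embed_mult ctrans_reverse_embed reverse_embed_one)
  from reverse_embed_inject[OF _ _ this] have "u * ctrans u = 1\<^sub>m N"
    using u by (simp add: mult_carrier_mat[of _ N N])
  with u gu show thesis by (intro that unitary_grpI)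
qed

lemma unitary_equal_first_rows:
  assumes g: "g \<in> unitary_grp (Suc N)" and r: "r \<in> unitary_grp (Suc N)"
    and row: "\<And>j. j < Suc N \<Longrightarrow> g $$ (0,j) = r $$ (0,j)"
  obtains u where "u \<in> unitary_grp N" "g = reverse_embed N u * r"
proof -
  have "(g * ctrans r) $$ (0,j) = (if j = 0 then 1 else 0)" if j: "j < Suc N" for j
  proof -
    have "(g * ctrans r) $$ (0,j) = (\<Sum>l<Suc N. r $$ (0,l) * ctrans r $$ (l,j))"
      using g r j row
      by (simp add: mult_mat_entry[of _ "Suc N" "Suc N" _ "Suc N"] del: sum.lessThan_Suc)
    also have "\<dots> = (r * ctrans r) $$ (0,j)"
      using r j by (intro mult_mat_entry[symmetric]) auto
    also have "\<dots> = (if j = 0 then 1 else 0)" using j by (simp add: unitary_mult_ctrans[OF r])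
    finally show ?thesis .
  qed
  then obtain u where u: "u \<in> unitary_grp N" "g * ctrans r = reverse_embed N u"
    using unitary_first_row_unit_vector[of "g * ctrans r" N] g r by auto
  have "g = g * ctrans r * r"
    using mult_unitary_cancel_right(2)[OF unitary_grp_carrier[OF g] r] ..
  with u show thesis using that by simp
qed

lemma reverse_embed_block_unitary:
  assumes x: "x \<in> block_unitary N blk"
    and blk: "\<And>i j. i < N \<Longrightarrow> j < N \<Longrightarrow> blk i = blk j \<Longrightarrow> blk' (N - i) = blk' (N - j)"
  shows "reverse_embed N x \<in> block_unitary (Suc N) blk'"
proof -
  have "reverse_embed N x $$ (i,j) = 0" if ij: "i < Suc N" "j < Suc N" "blk' i \<noteq> blk' j" for i j
  proof (cases "i = 0 \<or> j = 0")
    case False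
    then have "blk (N - i) \<noteq> blk (N - j)" using blk[of "N - i" "N - j"] ij by auto
    then show ?thesis using x ij False by (simp add: block_unitary_def)
  qed (use ij in auto)
  then show ?thesis
    using reverse_embed_unitary[OF block_unitary_unitary[OF x]] by (simp add: block_unitary_def)
qed

lemma reverse_embed_L_grp:
  assumes x: "x \<in> L_grp a b"
  shows "reverse_embed (1 + a + b) x \<in> H_grp (Suc b) (Suc a)"
proof -
  have "reverse_embed (1 + a + b) x \<in> block_unitary (Suc (1 + a + b)) (\<lambda>i. if i < Suc b then 0 else 1)"
    using x unfolding L_grp_def by (rule reverse_embed_block_unitary) (auto split: if_splits)
  moreover have "Suc (1 + a + b) = Suc b + Suc a" by simp
  ultimately show ?thesis unfolding H_grp_def by (simp only:)
qed

lemma reverse_embed_H_grp: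
  assumes h: "h \<in> H_grp b a"
  shows "reverse_embed (b + a) h \<in> L_grp a b"
proof -
  have "reverse_embed (b + a) h \<in>
      block_unitary (Suc (b + a)) (\<lambda>i. if i = 0 then 0 else if i \<le> a then 1 else 2)"
    using h unfolding H_grp_def by (rule reverse_embed_block_unitary) (auto split: if_splits)
  moreover have "Suc (b + a) = 1 + a + b" by simp
  ultimately show ?thesis unfolding L_grp_def by (simp only:)
qed

definition reverse_angles :: "nat \<Rightarrow> (nat \<Rightarrow> real) \<Rightarrow> nat \<Rightarrow> real" where
  "reverse_angles N t a = (if 0 < a \<and> a \<le> N then t (N - a) else 0)"

lemma reverse_angles_opposite:
  assumes t: "t \<in> mirror_angles N c k" and c: "c \<le> N" and ab: "a + b = 2 * N - c"
  shows "reverse_angles N t b = - reverse_angles N t a"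
proof -
  have nonzero: "reverse_angles N t e = - reverse_angles N t d"
    if de: "d + e = 2 * N - c" and nz: "reverse_angles N t d \<noteq> 0" for d e
  proof -
    have d: "0 < d" "d \<le> N" "t (N - d) \<noteq> 0"
      using nz by (auto simp: reverse_angles_def split: if_splits)
    note partner = mirror_angles_partner[OF t d(3)]
    have "N - e = c - (N - d)" "0 < e" "e \<le> N" using de d c partner(1,2) by linarith+
    then show ?thesis using d partner(3) by (simp add: reverse_angles_def)
  qed
  show ?thesis
    using nonzero[of a b] nonzero[of b a] ab by (cases "reverse_angles N t a = 0") auto
qed

lemma reverse_angles_mirror_angles:
  assumes t: "t \<in> mirror_angles N c k" and c: "c \<le> N"
  shows "reverse_angles N t \<in> mirror_angles (Suc N) (2 * N - c) (N + k - c)"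
  unfolding mirror_angles_def
proof (intro CollectI conjI allI impI)
  fix a assume "Suc N \<le> a \<or> 2 * N - c < a"
  then show "reverse_angles N t a = 0" using c by (auto simp: reverse_angles_def)
next
  fix a assume "N + k - c \<le> a \<and> a + (N + k - c) \<le> 2 * N - c"
  then have "k \<le> N - a \<and> N - a + k \<le> c" using c by linarith
  then have "t (N - a) = 0" using t unfolding mirror_angles_def by blast
  then show "reverse_angles N t a = 0" by (simp add: reverse_angles_def)
qed (rule reverse_angles_opposite[OF t c])

lemma reverse_embed_mirror_rotation:
  assumes t: "t \<in> mirror_angles N c k" and c: "c \<le> N"
  shows "reverse_embed N (mirror_rotation N c t) =
    mirror_rotation (Suc N) (2 * N - c) (reverse_angles N t)"
    (is "?L = ?R")
proof (rule eq_matI)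
  fix a b assume "a < dim_row ?R" "b < dim_col ?R"
  then have ab: "a < Suc N" "b < Suc N" by (auto simp: mirror_rotation_def)
  have "N - a + (N - b) = c \<longleftrightarrow> a + b = 2 * N - c" "N - a = N - b \<longleftrightarrow> a = b"
    using ab c by auto
  moreover have "reverse_angles N t 0 = 0" by (simp add: reverse_angles_def)
  moreover have "reverse_angles N t a = 0" if "a = 2 * N - c"
    using reverse_angles_opposite[OF t c, of a 0] that by (simp add: reverse_angles_def)
  ultimately show "?L $$ (a,b) = ?R $$ (a,b)"
    using ab by (cases "a = 0 \<or> b = 0") (auto simp: reverse_angles_def)
qed (auto simp: reverse_embed_def mirror_rotation_def)

lemma reverse_embed_mirror_torus:
  "z \<in> mirror_torus N c k \<Longrightarrow> c \<le> N \<Longrightarrow>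
     reverse_embed N z \<in> mirror_torus (Suc N) (2 * N - c) (N + k - c)"
  by (auto simp: mirror_torus_def reverse_embed_mirror_rotation reverse_angles_mirror_angles)

section \<open>The herringbone induction\<close>

lemma corner_rotation:
  assumes "0 < N"
  obtains r where "r \<in> mirror_torus (Suc N) N 1"
    "\<And>j. j < Suc N \<Longrightarrow> r $$ (0,j) =
       (if j = 0 then of_real (cos \<theta>) else if j = N then of_real (sin \<theta>) else 0)"
proof
  define t where "t i = (if i = 0 then \<theta> else if i = N then - \<theta> else 0)" for i
  have "t \<in> mirror_angles (Suc N) N 1" using assms by (auto simp: mirror_angles_def t_def)
  then show "mirror_rotation (Suc N) N t \<in> mirror_torus (Suc N) N 1" by (simp add: mirror_torus_def)
  show "mirror_rotation (Suc N) N t $$ (0,j) =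
      (if j = 0 then of_real (cos \<theta>) else if j = N then of_real (sin \<theta>) else 0)"
    if "j < Suc N" for j
    using that assms by (simp add: t_def)
qed

lemma corner_factorization:
  assumes g: "g \<in> unitary_grp (Suc N)" and N: "Suc N = p + q" and p: "0 < p" and q: "0 < q"
  obtains u r h where "u \<in> unitary_grp N" "r \<in> mirror_torus (Suc N) N 1" "h \<in> H_grp p q"
    "g = reverse_embed N u * r * h"
proof -
  obtain h \<theta> where h: "h \<in> H_grp p q" and row_gh: "\<And>j. j < Suc N \<Longrightarrow> (g * h) $$ (0,j) =
      (if j = 0 then of_real (cos \<theta>) else if j = p + q - 1 then of_real (sin \<theta>) else 0)"
    using H_grp_reduces_first_row[OF g[unfolded N] p q] unfolding N by blast
  have "0 < N" using N p q by simp
  then obtain r where r: "r \<in> mirror_torus (Suc N) N 1" and row_r: "\<And>j. j < Suc N \<Longrightarrow> r $$ (0,j) =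
      (if j = 0 then of_real (cos \<theta>) else if j = N then of_real (sin \<theta>) else 0)"
    using corner_rotation[of N \<theta>] by blast
  have hU: "h \<in> unitary_grp (Suc N)" using H_grp_unitary[OF h] N by simp
  have "(g * h) $$ (0,j) = r $$ (0,j)" if "j < Suc N" for j
    unfolding row_gh[OF that] row_r[OF that] by (simp flip: N)
  then obtain u where u: "u \<in> unitary_grp N" "g * h = reverse_embed N u * r"
    using unitary_equal_first_rows[OF unitary_mult[OF g hU] mirror_torus_unitary[OF r]] by blast
  have "g = g * h * ctrans h"
    using mult_unitary_cancel_right(1)[OF unitary_grp_carrier[OF g] hU] ..
  then have "g = reverse_embed N u * r * ctrans h" by (simp only: u)
  then show thesis by (rule that[OF u(1) r H_grp_ctrans[OF h]])
qed

text \<open>The normalisation of the \<open>U(1)\<close>-component of \<open>x\<close> makes the induction work: it lets the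
  embedded left factor commute with the corner rotation.\<close>

definition herringbone_set :: "nat \<Rightarrow> nat \<Rightarrow> nat \<Rightarrow> nat \<Rightarrow> complex mat set" where
  "herringbone_set n2 n3 p q = {x * (y * z) * h | x y z h.
     x \<in> L_grp n2 n3 \<and> x $$ (0,0) = 1 \<and> h \<in> H_grp p q \<and>
     y \<in> mirror_torus (p + q) (p + q) (Suc (min (min p q) (min n2 n3))) \<and>
     z \<in> mirror_torus (p + q) (p + q - 1) (min (min p q) (min (Suc n2) (Suc n3)))}"

lemma reverse_embed_L_grp_commutes_corner_rotation:
  assumes x: "x \<in> L_grp a b" and x00: "x $$ (0,0) = 1" and N: "N = 1 + a + b"
    and r: "r \<in> mirror_torus (Suc N) N 1"
  shows "reverse_embed N x * r = r * reverse_embed N x"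
proof (rule fixes_coords_commute)
  have "x $$ (i,j) = (if i = j then 1 else 0)" if "i < N" "j < N" "i = 0 \<or> j = 0" for i j
    using x x00 that unfolding L_grp_def block_unitary_def N by auto
  then show "fixes_coords (Suc N) {0, N} (reverse_embed N x)" by (auto simp: fixes_coords_def)
  show "fixes_coords (Suc N) (- {0, N}) r"
    by (rule fixes_coords_subset[OF mirror_torus_fixes_coords[OF r]]) auto
qed (use mirror_torus_unitary[OF r] in auto)

lemma reverse_embed_herringbone:
  assumes N: "N = n2 + n3" "N = 1 + q + p"
    and u: "u \<in> unitary_grp N" and ctrans_u: "ctrans u \<in> herringbone_set q p n3 n2"
  obtains x y z h where "x \<in> L_grp n2 n3" "x $$ (0,0) = 1" "h \<in> H_grp (Suc p) (Suc q)"
    "y \<in> mirror_torus (Suc N) (Suc N) (Suc (min (min (Suc p) (Suc q)) (min n2 n3)))"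
    "z \<in> mirror_torus (Suc N) N (min (min (Suc p) (Suc q)) (min (Suc n2) (Suc n3)))"
    "\<And>r. r \<in> mirror_torus (Suc N) N 1 \<Longrightarrow> h * r = r * h"
    "reverse_embed N u = x * (y * z * h)"
proof -
  let ?E = "reverse_embed N"
  obtain x y z h where x: "x \<in> L_grp q p" "x $$ (0,0) = 1" and h: "h \<in> H_grp n3 n2"
    and y: "y \<in> mirror_torus N N (Suc (min (min n3 n2) (min q p)))"
    and z: "z \<in> mirror_torus N (N - 1) (min (min n3 n2) (min (Suc q) (Suc p)))"
    and u_eq: "ctrans u = x * (y * z) * h"
    using ctrans_u unfolding herringbone_set_def N(1) add.commute[of n3] by blast
  have xU: "x \<in> unitary_grp N" and hU: "h \<in> unitary_grp N"
    using L_grp_unitary[OF x(1)] H_grp_unitary[OF h] N by (simp_all add: add.commute)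
  note factors = xU hU mirror_torus_unitary[OF y] mirror_torus_unitary[OF z]
  have "u = ctrans h * (ctrans z * ctrans y * ctrans x)"
    using arg_cong[OF u_eq, of ctrans] factors by (simp add: ctrans_mult[of _ N N _ N])
  then have "?E u = ?E (ctrans h) * (?E (ctrans z) * ?E (ctrans y) * ?E (ctrans x))"
    using factors by (simp add: reverse_embed_mult)
  moreover have "?E (ctrans h) \<in> L_grp n2 n3" "?E (ctrans h) $$ (0,0) = 1"
    using reverse_embed_H_grp[OF H_grp_ctrans[OF h]] N(1) by (simp_all add: add.commute)
  moreover have "?E (ctrans z) \<in>
      mirror_torus (Suc N) (Suc N) (Suc (min (min (Suc p) (Suc q)) (min n2 n3)))"
    using reverse_embed_mirror_torus[OF mirror_torus_ctrans[OF z]] N(2)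
    by (simp add: min.commute min.left_commute min.assoc add.commute)
  moreover have "?E (ctrans y) \<in>
      mirror_torus (Suc N) N (min (min (Suc p) (Suc q)) (min (Suc n2) (Suc n3)))"
    using reverse_embed_mirror_torus[OF mirror_torus_ctrans[OF y]]
    by (simp add: min.commute min.left_commute min.assoc)
  moreover have "?E (ctrans x) \<in> H_grp (Suc p) (Suc q)"
    using reverse_embed_L_grp[OF L_grp_ctrans[OF x(1)]] N(2) by simp
  moreover have "ctrans x $$ (0,0) = 1"
    using x(2) N(2) ctrans_entry[OF unitary_grp_carrier[OF xU], of 0 0] by simp
  then have "?E (ctrans x) * r = r * ?E (ctrans x)" if "r \<in> mirror_torus (Suc N) N 1" for r
    using N(2) that by (rule reverse_embed_L_grp_commutes_corner_rotation[OF L_grp_ctrans[OF x(1)]])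
  ultimately show thesis using that by blast
qed

lemma herringbone_step:
  assumes N: "N = n2 + n3" "N = 1 + q + p"
    and u: "u \<in> unitary_grp N" and ctrans_u: "ctrans u \<in> herringbone_set q p n3 n2"
    and r: "r \<in> mirror_torus (Suc N) N 1" and h\<^sub>0: "h\<^sub>0 \<in> H_grp (Suc p) (Suc q)"
  shows "reverse_embed N u * r * h\<^sub>0 \<in> herringbone_set n2 n3 (Suc p) (Suc q)"
proof -
  let ?k = "min (min (Suc p) (Suc q)) (min (Suc n2) (Suc n3))"
  obtain x y z h where x: "x \<in> L_grp n2 n3" "x $$ (0,0) = 1" and h: "h \<in> H_grp (Suc p) (Suc q)"
    and y: "y \<in> mirror_torus (Suc N) (Suc N) (Suc (min (min (Suc p) (Suc q)) (min n2 n3)))"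
    and z: "z \<in> mirror_torus (Suc N) N ?k"
    and commute: "h * r = r * h" and Eu: "reverse_embed N u = x * (y * z * h)"
    using reverse_embed_herringbone[OF N u ctrans_u] r by metis
  have size: "Suc p + Suc q = Suc N" "1 + n2 + n3 = Suc N" using N by simp_all
  have carriers: "x \<in> carrier_mat (Suc N) (Suc N)" "y \<in> carrier_mat (Suc N) (Suc N)"
    "z \<in> carrier_mat (Suc N) (Suc N)" "h \<in> carrier_mat (Suc N) (Suc N)"
    "r \<in> carrier_mat (Suc N) (Suc N)" "h\<^sub>0 \<in> carrier_mat (Suc N) (Suc N)"
    using L_grp_unitary[OF x(1)] mirror_torus_unitary[OF y] mirror_torus_unitary[OF z]
      H_grp_unitary[OF h] mirror_torus_unitary[OF r] H_grp_unitary[OF h\<^sub>0]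
    unfolding size by auto
  have "reverse_embed N u * r * h\<^sub>0 = x * (y * (z * (h * r))) * h\<^sub>0"
    unfolding Eu using carriers
    by (simp add: assoc_mult_mat[of _ "Suc N" "Suc N" _ "Suc N" _ "Suc N"])
  also have "\<dots> = x * (y * (z * r)) * (h * h\<^sub>0)"
    unfolding commute using carriers
    by (simp add: assoc_mult_mat[of _ "Suc N" "Suc N" _ "Suc N" _ "Suc N"])
  finally have "reverse_embed N u * r * h\<^sub>0 = x * (y * (z * r)) * (h * h\<^sub>0)" .
  moreover have "z * r \<in> mirror_torus (Suc N) N ?k"
    using mirror_torus_mono[of 1 ?k] r by (intro mirror_torus_mult z) auto
  moreover have "h * h\<^sub>0 \<in> H_grp (Suc p) (Suc q)"
    by (rule H_grp_mult[OF h h\<^sub>0])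
  ultimately show ?thesis using x y unfolding herringbone_set_def size diff_Suc_1 by blast
qed

lemma unitary_grp_subset_herringbone_set:
  "1 + n2 + n3 = p + q \<Longrightarrow> unitary_grp (p + q) \<subseteq> herringbone_set n2 n3 p q"
proof (induction "p + q" arbitrary: n2 n3 p q)
  case (Suc N)
  note Suc_N = \<open>Suc N = p + q\<close>
  show ?case
  proof
    fix g assume "g \<in> unitary_grp (p + q)"
    then have g: "g \<in> unitary_grp (Suc N)" by (simp add: Suc_N)
    show "g \<in> herringbone_set n2 n3 p q"
    proof (cases "p = 0 \<or> q = 0")
      case True
      have "1\<^sub>m (p + q) \<in> L_grp n2 n3"
        using Suc.prems block_unitary_one by (simp add: L_grp_def)
      moreover have "g \<in> H_grp p q"
        using True g Suc_N by (auto simp: H_grp_def block_unitary_def)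
      moreover have "1\<^sub>m (p + q) $$ (0,0) = (1 :: complex)" by (simp flip: Suc_N)
      moreover have "g = 1\<^sub>m (p + q) * (1\<^sub>m (p + q) * 1\<^sub>m (p + q)) * g"
        using unitary_grp_carrier[OF g] Suc_N by simp
      ultimately show ?thesis unfolding herringbone_set_def using mirror_torus_one by blast
    next
      case False
      then obtain p' q' where pq: "p = Suc p'" "q = Suc q'" by (meson not0_implies_Suc)
      obtain u r h where u: "u \<in> unitary_grp N" and r: "r \<in> mirror_torus (Suc N) N 1"
        and h: "h \<in> H_grp p q" and g_eq: "g = reverse_embed N u * r * h"
        using corner_factorization[OF g Suc_N] pq by blast
      have N: "N = n2 + n3" "N = 1 + q' + p'" using Suc.prems Suc_N pq by auto
      have "ctrans u \<in> herringbone_set q' p' n3 n2"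
        using Suc.hyps(1)[of n3 n2 q' p'] unitary_ctrans[OF u] N by (auto simp: add.commute)
      then show ?thesis
        unfolding g_eq pq by (rule herringbone_step[OF N u _ r h[unfolded pq]])
    qed
  qed
qed simp

theorem theorem3p1:
  fixes n2 n3 p q n l :: nat
  assumes "0 < n2" "0 < n3" "0 < p" "0 < q"
    and "n = 1 + n2 + n3" "n = p + q"
    and "l = min (min (2*p) (2*q)) (min (2*n2+1) (2*n3+1))"
  shows "unitary_grp n =
    {x * b * h | x b h. x \<in> L_grp n2 n3 \<and> h \<in> H_grp p q \<and>
       b \<in> {y * z | y z. y \<in> mexp ` b2 n (l div 2) \<and> z \<in> mexp ` b1 n ((l+1) div 2)}}"
proof -
  have l: "l div 2 = min (min p q) (min n2 n3)"
    "(l + 1) div 2 = min (min p q) (min (Suc n2) (Suc n3))"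
    using assms(7) by (auto simp: min_def)
  have B'': "mexp ` b2 n (l div 2) = mirror_torus n n (Suc (l div 2))"
    using assms(5) l(1) by (subst b2_eq_mirror_generators) (auto simp: mexp_image_mirror_generator)
  have B': "mexp ` b1 n ((l + 1) div 2) = mirror_torus n (n - 1) ((l + 1) div 2)"
    using assms(6) l(2)
    by (subst b1_eq_mirror_generators) (auto simp: mexp_image_mirror_generator min_def)
  show ?thesis unfolding B' B''
  proof (intro equalityI subsetI)
    fix g assume "g \<in> unitary_grp n"
    then have "g \<in> herringbone_set n2 n3 p q"
      using unitary_grp_subset_herringbone_set[of n2 n3 p q] assms(5,6) by auto
    then show "g \<in> {x * b * h | x b h. x \<in> L_grp n2 n3 \<and> h \<in> H_grp p q \<and> b \<in> {y * z | y z.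
        y \<in> mirror_torus n n (Suc (l div 2)) \<and> z \<in> mirror_torus n (n - 1) ((l+1) div 2)}}"
      unfolding herringbone_set_def l assms(6) by blast
  qed (use L_grp_unitary H_grp_unitary mirror_torus_unitary assms(5,6) in
      \<open>fastforce intro!: unitary_mult\<close>)
qed

end
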